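(* Let $\alpha$ be an arbitrary real number with (finite or infinite) continued fraction representation $\alpha=[a_0;a_1,a_2,\dots]$, and let $\frac{p_k}{q_k}=[a_0;a_1,\dots,a_{k-1}]$ denote its convergents. Let $p>1$ be a real number and $\ell$ a positive integer (which, when $\alpha$ is rational, is at most the number of partial quotients). Then \[\left(\sum_{0<m<q_\ell}\frac{1}{m^p\|m\alpha\|^p}\right)^{1/p}=\left(\sum_{0<k<\ell}\zeta(2p)a_k^p\right)^{1/p}+O\left(\ell^{1/p}\right),\] where $\zeta$ is the Riemann zeta function, and the implied constant is at most $6^p\frac{4p^2}{(p-1)^2}$; that is, the absolute value of the difference of the two sides is at most $6^p\frac{4p^2}{(p-1)^2}\ell^{1/p}$.
   Context: $\|x\|$ denotes the distance from $x$ to the nearest integer. Convergents are indexed so that $\frac{p_k}{q_k}=a_0+\cfrac{1}{a_1+\cfrac{1}{\ddots+\cfrac{1}{a_{k-1}}}}$; in particular $q_1=1$, $q_2=a_1$ and $q_{k+1}=a_kq_k+q_{k-1}$ for $k\ge2$. For rational $\alpha$ either of its two continued fraction representations may be used. *)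

theory Defs
  imports "HOL-Analysis.Analysis" "HOL-Library.Extended_Nat"
begin

definition nearest_int_dist :: "real \<Rightarrow> real"
  where "nearest_int_dist x = \<bar>x - of_int (round x)\<bar>"

text \<open>The Dirichlet series of the Riemann zeta function; the value is meaningful only for
  real \<open>s > 1\<close>.\<close>

definition zeta_real :: "real \<Rightarrow> real"
  where "zeta_real s = (\<Sum>n. 1 / real (Suc n) powr s)"

text \<open>The value of the finite continued fraction \<open>[x\<^sub>0; x\<^sub>1, \<dots>, x\<^sub>n]\<close>. The value for the
  empty list is a dummy.\<close>

fun cf_value :: "real list \<Rightarrow> real" where
  "cf_value [] = 0"
| "cf_value [x] = x"
| "cf_value (x # y # xs) = x + 1 / cf_value (y # xs)"

text \<open>\<open>[a\<^sub>0; a\<^sub>1, \<dots>, a\<^bsub>k-1\<^esub>]\<close>, so that the index \<open>k\<close> is the number of partial quotients used.\<close>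

definition cf_convergent :: "(nat \<Rightarrow> int) \<Rightarrow> nat \<Rightarrow> real"
  where "cf_convergent a k = cf_value (map (\<lambda>i. real_of_int (a i)) [0..<k])"

text \<open>\<open>cf_expansion a N \<alpha>\<close>: the partial quotients \<open>a\<^sub>i\<close> with \<open>i < N\<close> form a continued fraction
  representation of \<open>\<alpha>\<close>. Here \<open>N\<close> counts the partial quotients including \<open>a\<^sub>0\<close>, and \<open>N = \<infinity>\<close> is the
  case of an infinite continued fraction; values \<open>a i\<close> with \<open>i \<ge> N\<close> are irrelevant. The last
  partial quotient of a finite representation is allowed to be 1, so that both representations
  of a rational number are covered.\<close>

definition cf_expansion :: "(nat \<Rightarrow> int) \<Rightarrow> enat \<Rightarrow> real \<Rightarrow> bool"
  where "cf_expansion a N \<alpha> \<longleftrightarrow>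
    N > 0 \<and> (\<forall>i>0. enat i < N \<longrightarrow> a i \<ge> 1) \<and>
    (case N of
       enat n \<Rightarrow> \<alpha> = cf_convergent a n
     | \<infinity> \<Rightarrow> cf_convergent a \<longlonglongrightarrow> \<alpha>)"

text \<open>Numerators and denominators of the convergents. The values at 0 extend the recurrences
  backwards; lemmas \<open>cf_convergent_eq\<close> and \<open>cf_num_den_coprime\<close> below show that these are the
  reduced numerator and denominator of \<open>cf_convergent a k\<close> for \<open>k \<ge> 1\<close>, provided that
  \<open>a\<^sub>i \<ge> 1\<close> for \<open>0 < i < k\<close>.\<close>

fun cf_num :: "(nat \<Rightarrow> int) \<Rightarrow> nat \<Rightarrow> int" where
  "cf_num a 0 = 1"
| "cf_num a (Suc 0) = a 0"
| "cf_num a (Suc (Suc k)) = a (Suc k) * cf_num a (Suc k) + cf_num a k"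

fun cf_den :: "(nat \<Rightarrow> int) \<Rightarrow> nat \<Rightarrow> int" where
  "cf_den a 0 = 0"
| "cf_den a (Suc 0) = 1"
| "cf_den a (Suc (Suc k)) = a (Suc k) * cf_den a (Suc k) + cf_den a k"

lemma cf_den_pos:
  assumes "\<And>i. 0 < i \<Longrightarrow> i < k \<Longrightarrow> a i \<ge> 1"
  shows "cf_den a k \<ge> 0 \<and> (k > 0 \<longrightarrow> cf_den a k \<ge> 1)"
  using assms
proof (induction a k rule: cf_den.induct)
  case (3 a k)
  have "cf_den a (Suc k) \<ge> 1" "cf_den a k \<ge> 0" "a (Suc k) \<ge> 1"
    using "3.IH" "3.prems" by auto
  moreover from this have "1 * 1 \<le> a (Suc k) * cf_den a (Suc k)"
    by (intro mult_mono) auto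
  ultimately show ?case by simp
qed auto

lemma cf_num_den_det:
  "cf_num a (Suc k) * cf_den a k - cf_num a k * cf_den a (Suc k) = (-1) ^ Suc k"
proof (induction k)
  case (Suc k)
  then show ?case by (simp add: algebra_simps)
qed auto

lemma cf_num_den_coprime: "coprime (cf_num a k) (cf_den a k)"
proof (rule coprimeI)
  fix d assume "d dvd cf_num a k" "d dvd cf_den a k"
  then have "d dvd cf_num a (Suc k) * cf_den a k - cf_num a k * cf_den a (Suc k)"
    by simp
  then have "d dvd (-1) ^ Suc k"
    unfolding cf_num_den_det .
  then show "is_unit d"
    by (metis dvd_trans is_unit_power_iff minus_dvd_iff dvd_refl)
qed

lemma cf_value_snoc2: "cf_value (xs @ [y, z]) = cf_value (xs @ [y + 1 / z])"
proof (induction xs rule: cf_value.induct)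
  case (2 x)
  then show ?case by simp
qed auto

lemma cf_value_snoc:
  assumes "\<And>i. 0 < i \<Longrightarrow> i \<le> k \<Longrightarrow> a i \<ge> 1" and "x > 0"
  shows "cf_value (map (\<lambda>i. real_of_int (a i)) [0..<Suc k] @ [x]) =
    (x * cf_num a (Suc k) + cf_num a k) / (x * cf_den a (Suc k) + cf_den a k)"
  using assms
proof (induction k arbitrary: x)
  case 0
  then show ?case by (simp add: field_simps)
next
  case (Suc k)
  have pos: "a (Suc k) + 1 / x > 0"
    using Suc.prems by (smt (verit) Suc_leI divide_pos_pos le_refl of_int_1_le_iff zero_less_Suc)
  have "cf_value (map (\<lambda>i. real_of_int (a i)) [0..<Suc (Suc k)] @ [x]) =
      cf_value (map (\<lambda>i. real_of_int (a i)) [0..<Suc k] @ [a (Suc k) + 1 / x])"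
    using cf_value_snoc2[of "map (\<lambda>i. real_of_int (a i)) [0..<Suc k]"] by simp
  also have "\<dots> = ((a (Suc k) + 1 / x) * cf_num a (Suc k) + cf_num a k) /
      ((a (Suc k) + 1 / x) * cf_den a (Suc k) + cf_den a k)"
    using Suc.IH[OF _ pos] Suc.prems by simp
  also have "\<dots> = (x * ((a (Suc k) + 1 / x) * cf_num a (Suc k) + cf_num a k)) /
      (x * ((a (Suc k) + 1 / x) * cf_den a (Suc k) + cf_den a k))"
    using Suc.prems(2) by simp
  also have "\<dots> = (x * cf_num a (Suc (Suc k)) + cf_num a (Suc k)) /
      (x * cf_den a (Suc (Suc k)) + cf_den a (Suc k))"
    using Suc.prems(2) by (intro arg_cong2[where f = "(/)"]) (simp_all add: algebra_simps)
  finally show ?case .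
qed

lemma cf_convergent_eq:
  assumes "\<And>i. 0 < i \<Longrightarrow> i < k \<Longrightarrow> a i \<ge> 1" and "k \<ge> 1"
  shows "cf_convergent a k = cf_num a k / cf_den a k"
proof (cases "k = 1")
  case True
  then show ?thesis by (simp add: cf_convergent_def)
next
  case False
  then obtain j where k: "k = Suc (Suc j)"
    using assms(2) by (metis One_nat_def not0_implies_Suc not_one_le_zero)
  have "real_of_int (a (Suc j)) > 0"
    using assms(1)[of "Suc j"] k by simp
  then show ?thesis
    using cf_value_snoc[of j a "a (Suc j)"] assms(1) k
    by (simp add: cf_convergent_def mult.commute)
qed

end

theory Submission
  imports Defs
begin

text \<open>
  Split the range \<open>0 < m < q\<^sub>l\<close> into the blocks \<open>q\<^sub>k \<le> m < q\<^bsub>k+1\<^esub>\<close>. By Minkowski's inequality it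
  suffices that the \<open>p\<close>-norm of the \<open>k\<close>-th block differs from \<open>\<zeta>(2p)\<^bsup>1/p\<^esup> a\<^sub>k\<close> by a bounded amount.
  Write \<open>q = q\<^sub>k\<close>, \<open>Q = q\<^bsub>k+1\<^esub>\<close>, \<open>P = p\<^sub>k\<close> and \<open>\<delta> = q \<alpha> - P\<close>, where by symmetry \<open>\<delta> > 0\<close>. If \<open>n\<close> is the
  integer nearest to \<open>m \<alpha>\<close> and \<open>s = m P - n q\<close>, then \<open>m \<alpha> - n = (s + m \<delta>) / q\<close> with \<open>0 < m \<delta> < 1\<close>.

  The terms with \<open>s = 0\<close> have \<open>m = j q\<close> and equal \<open>(q \<delta>)\<^bsup>-p\<^esup> j\<^bsup>-2p\<^esup>\<close> with \<open>a\<^sub>k \<le> 1 / (q \<delta>) \<le> a\<^sub>k + 2\<close>; all \<open>j < a\<^sub>k / 2\<close>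
  occur, and for the remaining \<open>j\<close> one has \<open>a\<^sub>k / j\<^sup>2 \<le> 2 / j\<close>. The terms with \<open>s \<notin> {0, -1}\<close> are
  controlled by \<open>\<zeta>(p)\<^sup>2\<close>, because \<open>m\<close> is determined by \<open>m div q\<close> and \<open>s\<close>. If \<open>s = -1\<close>, then
  \<open>m = Q - i q\<close>, and the term is at most \<open>(1 / i + q / m)\<^sup>p\<close>.
\<close>

subsection \<open>Minkowski's inequality and zeta sums\<close>

text \<open>For positive \<open>x\<close> and \<open>y\<close> this is the usual convexity; if one
  of them vanishes, it reduces to \<open>s powr p \<le> s\<close> on the unit interval.\<close>

lemma powr_convex_nonneg:
  fixes x y t p :: real
  assumes "p \<ge> 1" "x \<ge> 0" "y \<ge> 0" "0 \<le> t" "t \<le> 1"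
  shows "(t * x + (1 - t) * y) powr p \<le> t * x powr p + (1 - t) * y powr p"
proof -
  have shrink: "s powr p \<le> s" if "0 \<le> s" "s \<le> 1" for s :: real
    using powr_mono'[of 1 p s] that assms(1) by (cases "s = 0") auto
  consider "x = 0" | "y = 0" | "x > 0" "y > 0"
    using assms by fastforce
  then show ?thesis
  proof cases
    case 1
    then show ?thesis
      using shrink[of "1 - t"] assms by (simp add: powr_mult mult_right_mono)
  next
    case 2
    then show ?thesis
      using shrink[of t] assms by (simp add: powr_mult mult_right_mono)
  next
    case 3
    then show ?thesis
      using convex_onD[OF powr_convex[OF assms(1)], of "1 - t" x y] assms
      by (simp add: algebra_simps)
  qed
qed

text \<open>With u and v the two norms, (x + y) / (u + v) is the convex combination of x / u and y /
  v with weight u / (u + v), and the p-th powers of either normalised vector sum to 1. For infinite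
  \<open>A\<close> both sides are 0.\<close>

lemma Minkowski_sum:
  fixes x y :: "'a \<Rightarrow> real"
  assumes "p \<ge> 1" and x: "\<And>i. i \<in> A \<Longrightarrow> x i \<ge> 0" and y: "\<And>i. i \<in> A \<Longrightarrow> y i \<ge> 0"
  shows "(\<Sum>i\<in>A. (x i + y i) powr p) powr (1 / p) \<le>
    (\<Sum>i\<in>A. x i powr p) powr (1 / p) + (\<Sum>i\<in>A. y i powr p) powr (1 / p)"
proof (cases "finite A")
  case True
  define X where "X = (\<Sum>i\<in>A. x i powr p)"
  define Y where "Y = (\<Sum>i\<in>A. y i powr p)"
  have [simp]: "X \<ge> 0" "Y \<ge> 0"
    by (auto simp: X_def Y_def sum_nonneg)
  consider "X = 0" | "Y = 0" | "X > 0" "Y > 0"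
    using \<open>X \<ge> 0\<close> \<open>Y \<ge> 0\<close> by linarith
  then show ?thesis
  proof cases
    case 1
    then have "x i = 0" if "i \<in> A" for i
      using that True by (simp add: X_def sum_nonneg_eq_0_iff)
    then show ?thesis
      by simp
  next
    case 2
    then have "y i = 0" if "i \<in> A" for i
      using that True by (simp add: Y_def sum_nonneg_eq_0_iff)
    then show ?thesis
      by simp
  next
    case 3
    define u where "u = X powr (1 / p)"
    define v where "v = Y powr (1 / p)"
    define t where "t = u / (u + v)"
    have uv: "u > 0" "v > 0" "u powr p = X" "v powr p = Y"
      using 3 assms(1) by (auto simp: u_def v_def powr_powr)
    have t: "0 \<le> t" "t \<le> 1" "1 - t = v / (u + v)"
      using uv by (auto simp: t_def field_simps)
    have "(\<Sum>i\<in>A. (x i + y i) powr p) / (u + v) powr p = (\<Sum>i\<in>A. ((x i + y i) / (u + v)) powr p)"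
      by (simp add: sum_divide_distrib powr_divide)
    also have "\<dots> = (\<Sum>i\<in>A. (t * (x i / u) + (1 - t) * (y i / v)) powr p)"
      using uv unfolding t(3) by (simp add: t_def add_divide_distrib)
    also have "\<dots> \<le> (\<Sum>i\<in>A. t * (x i / u) powr p + (1 - t) * (y i / v) powr p)"
      using assms uv t by (intro sum_mono powr_convex_nonneg) auto
    also have "\<dots> = t * (X / u powr p) + (1 - t) * (Y / v powr p)"
      by (simp add: X_def Y_def sum.distrib powr_divide sum_divide_distrib sum_distrib_left)
    also have "\<dots> = 1"
      using uv 3 by simp
    finally have "(\<Sum>i\<in>A. (x i + y i) powr p) \<le> (u + v) powr p"
      using uv by (simp add: divide_le_eq)
    then have "(\<Sum>i\<in>A. (x i + y i) powr p) powr (1 / p) \<le> ((u + v) powr p) powr (1 / p)"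
      using assms(1) by (intro powr_mono2) (auto simp: sum_nonneg)
    then show ?thesis
      using uv assms(1) by (simp add: powr_powr u_def v_def X_def Y_def)
  qed
qed simp

text \<open>Minkowski's inequality for two vectors indexed by \<open>bool\<close> with disjoint
  supports.\<close>

lemma powr_root_add_le:
  fixes u v p :: real
  assumes "p \<ge> 1" "u \<ge> 0" "v \<ge> 0"
  shows "(u + v) powr (1 / p) \<le> u powr (1 / p) + v powr (1 / p)"
proof -
  let ?x = "\<lambda>b. if b then u powr (1 / p) else 0"
  let ?y = "\<lambda>b. if b then 0 else v powr (1 / p)"
  show ?thesis
    using Minkowski_sum[of p "UNIV :: bool set" ?x ?y] assms
    by (simp add: UNIV_bool powr_powr add.commute)
qed

lemma powr_root_mono:
  fixes u v p :: real
  assumes "p > 1" "0 \<le> u" "u \<le> v"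
  shows "u powr (1 / p) \<le> v powr (1 / p)"
  using assms by (intro powr_mono2) auto

lemma powr_root_le_self:
  fixes u v p :: real
  assumes "p > 1" "0 \<le> u" "u \<le> v" "1 \<le> v"
  shows "u powr (1 / p) \<le> v"
proof -
  have "u powr (1 / p) \<le> v powr (1 / p)"
    using assms by (intro powr_root_mono)
  also have "\<dots> \<le> v powr 1"
    using assms by (intro powr_mono) auto
  finally show ?thesis
    using assms by simp
qed

text \<open>A constant vector \<open>C\<close> has p-norm
  \<open>C * real (card A) powr (1 / p)\<close>. This turns a bounded error per block into the
  factor \<open>real l powr (1 / p)\<close>.\<close>

lemma Minkowski_sum_diff_le:
  fixes x y :: "'a \<Rightarrow> real"
  assumes "p > 1" "finite A" "\<And>i. i \<in> A \<Longrightarrow> x i \<ge> 0" "\<And>i. i \<in> A \<Longrightarrow> y i \<ge> 0"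
    and xy: "\<And>i. i \<in> A \<Longrightarrow> x i \<le> y i + C" and "C \<ge> 0"
  shows "(\<Sum>i\<in>A. x i powr p) powr (1 / p) \<le>
    (\<Sum>i\<in>A. y i powr p) powr (1 / p) + C * real (card A) powr (1 / p)"
proof -
  have "(\<Sum>i\<in>A. x i powr p) powr (1 / p) \<le> (\<Sum>i\<in>A. (y i + C) powr p) powr (1 / p)"
    using assms by (intro powr_root_mono sum_mono powr_mono2 sum_nonneg) auto
  also have "\<dots> \<le> (\<Sum>i\<in>A. y i powr p) powr (1 / p) + (\<Sum>i\<in>A. C powr p) powr (1 / p)"
    using assms by (intro Minkowski_sum) auto
  also have "(\<Sum>i\<in>A. C powr p) powr (1 / p) = C * real (card A) powr (1 / p)"
    using assms by (simp add: powr_mult powr_powr)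
  finally show ?thesis .
qed

section \<open>Bounds for the zeta series and its subsums\<close>

lemma summable_zeta_real:
  assumes "s > 1"
  shows "summable (\<lambda>n. 1 / real (Suc n) powr s)"
proof -
  have "summable (\<lambda>n. real (Suc n) powr - s)"
    using summable_real_powr_iff[of "- s"] assms by (subst summable_Suc_iff) simp
  then show ?thesis
    by (simp add: powr_minus divide_inverse)
qed

lemma zeta_real_ge_1:
  assumes "s > 1"
  shows "zeta_real s \<ge> 1"
  using sum_le_suminf[OF summable_zeta_real[OF assms], of "{0}"] by (simp add: zeta_real_def)

lemma zeta_real_antimono:
  assumes "1 < s" "s \<le> t"
  shows "zeta_real t \<le> zeta_real s"
  unfolding zeta_real_def using assms
  by (intro suminf_le summable_zeta_real divide_left_mono powr_mono) auto

text \<open>Integral comparison: by the mean value theorem each term after the first is at most a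
  difference of values of x^(1-s) / (s-1), and these telescope to at most 1 / (s-1).\<close>

lemma zeta_real_le:
  assumes "s > 1"
  shows "zeta_real s \<le> s / (s - 1)"
proof -
  have step: "1 / real (Suc (Suc n)) powr s \<le>
      (real (Suc n) powr (1 - s) - real (Suc (Suc n)) powr (1 - s)) / (s - 1)" for n
  proof -
    let ?f = "\<lambda>x. x powr (1 - s) / (1 - s)"
    have "(?f has_real_derivative x powr - s) (at x)" if "x > 0" for x
      using that assms by (auto intro!: derivative_eq_intros)
    then obtain z where z: "real (Suc n) < z" "z < real (Suc (Suc n))"
      "?f (real (Suc (Suc n))) - ?f (real (Suc n)) = (real (Suc (Suc n)) - real (Suc n)) * z powr - s"
      using MVT2[of "real (Suc n)" "real (Suc (Suc n))" ?f "\<lambda>x. x powr - s"] by force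
    have "real (Suc (Suc n)) powr - s \<le> z powr - s"
      using z assms by (intro powr_mono2') auto
    then show ?thesis
      using z(3) minus_divide_right[of "real (Suc n) powr (1 - s) - real (Suc (Suc n)) powr (1 - s)" "s - 1"]
      by (simp add: powr_minus divide_inverse algebra_simps)
  qed
  \<comment> \<open>The telescoped remainder is kept on the right so that the induction
    closes.\<close>
  have "(\<Sum>i<Suc n. 1 / real (Suc i) powr s) \<le> s / (s - 1) - real (Suc n) powr (1 - s) / (s - 1)" for n
  proof (induction n)
    case 0
    then show ?case
      using assms by (simp flip: diff_divide_distrib)
  next
    case (Suc n)
    then show ?case
      using step[of n] by (simp add: diff_divide_distrib)
  qed
  moreover have "real (Suc n) powr (1 - s) / (s - 1) \<ge> 0" for n
    using assms by simp
  ultimately have Suc_le: "(\<Sum>i<Suc n. 1 / real (Suc i) powr s) \<le> s / (s - 1)" for n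
    by (smt (verit))
  show ?thesis
    unfolding zeta_real_def
  proof (rule suminf_le_const[OF summable_zeta_real[OF assms]])
    fix n
    show "(\<Sum>i<n. 1 / real (Suc i) powr s) \<le> s / (s - 1)"
      using Suc_le[of "n - 1"] assms by (cases n) auto
  qed
qed

lemma sum_inverse_powr_le_zeta:
  fixes g :: "'a \<Rightarrow> int"
  assumes "s > 1" "finite A" "inj_on g A" "\<And>x. x \<in> A \<Longrightarrow> g x > 0"
  shows "(\<Sum>x\<in>A. 1 / real_of_int (g x) powr s) \<le> zeta_real s"
proof -
  \<comment> \<open>The Dirichlet series is indexed from 0, hence the shift by one.\<close>
  define h where "h x = nat (g x - 1)" for x
  have "inj_on h A"
    using assms(3,4) by (auto simp: inj_on_def h_def eq_nat_nat_iff)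
  have "real (Suc (h x)) = real_of_int (g x)" if "x \<in> A" for x
    using assms(4)[OF that] by (simp add: h_def)
  then have "(\<Sum>x\<in>A. 1 / real_of_int (g x) powr s) = (\<Sum>n\<in>h ` A. 1 / real (Suc n) powr s)"
    using \<open>inj_on h A\<close> by (simp add: sum.reindex)
  also have "\<dots> \<le> zeta_real s"
    unfolding zeta_real_def using assms
    by (intro sum_le_suminf summable_zeta_real) auto
  finally show ?thesis .
qed

text \<open>Only the pair of values is injective, so the sum is enlarged to the product of the two
  images, where it factors.\<close>

lemma sum_inverse_powr_mult_le_zeta_squared:
  fixes g h :: "'a \<Rightarrow> int"
  assumes "s > 1" "finite A" "inj_on (\<lambda>x. (g x, h x)) A"
    "\<And>x. x \<in> A \<Longrightarrow> g x > 0" "\<And>x. x \<in> A \<Longrightarrow> h x > 0"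
  shows "(\<Sum>x\<in>A. 1 / (real_of_int (g x) * real_of_int (h x)) powr s) \<le> (zeta_real s)\<^sup>2"
proof -
  let ?f = "\<lambda>i. 1 / real_of_int i powr s"
  have "(\<Sum>x\<in>A. 1 / (real_of_int (g x) * real_of_int (h x)) powr s) =
      (\<Sum>(i, j)\<in>(\<lambda>x. (g x, h x)) ` A. ?f i * ?f j)"
    using assms(3) by (simp add: sum.reindex powr_mult)
  also have "\<dots> \<le> (\<Sum>(i, j)\<in>g ` A \<times> h ` A. ?f i * ?f j)"
    using assms(2) by (intro sum_mono2) auto
  also have "\<dots> = (\<Sum>i\<in>g ` A. ?f i) * (\<Sum>j\<in>h ` A. ?f j)"
    by (simp add: sum_product sum.cartesian_product)
  also have "\<dots> \<le> zeta_real s * zeta_real s"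
    using assms zeta_real_ge_1[OF assms(1)]
    by (intro mult_mono sum_inverse_powr_le_zeta[of s _ "\<lambda>i. i"] sum_nonneg) auto
  finally show ?thesis
    by (simp add: power2_eq_square)
qed

subsection \<open>A single block\<close>

text \<open>\<open>round\<close> breaks ties asymmetrically, so the proof uses minimality of the
  nearest integer: it gives one inequality for every y, and x and -x together give equality.\<close>

lemma nearest_int_dist_minus: "nearest_int_dist (- x) = nearest_int_dist x"
proof -
  have le: "nearest_int_dist y \<le> \<bar>y - of_int n\<bar>" for y n
    using round_diff_minimal[of y n] by (simp add: nearest_int_dist_def)
  have "nearest_int_dist (- y) \<le> nearest_int_dist y" for y
    using le[of "- y" "- round y"] by (simp add: nearest_int_dist_def)
  from this[of x] this[of "- x"] show ?thesis
    by simp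
qed

lemma inverse_powr_mult_le:
  fixes x y c p :: real
  assumes "c > 0" "c \<le> x * y" "p > 0"
  shows "1 / (x powr p * y powr p) \<le> 1 / c powr p"
proof -
  have "c powr p \<le> (x * y) powr p"
    using assms by (intro powr_mono2) auto
  then show ?thesis
    using assms by (simp add: powr_mult frac_le)
qed

text \<open>\<open>P/q\<close> and \<open>P'/Q\<close> are consecutive convergents of \<open>\<alpha>\<close>, with \<open>P/q < \<alpha> \<le> P'/Q\<close>; the opposite
  order is covered by negating \<open>\<alpha>\<close>, \<open>P\<close> and \<open>P'\<close>.\<close>

locale consecutive_convergents =
  fixes \<alpha> :: real and q Q P P' a :: int
  assumes q_pos: "q \<ge> 1" and a_pos: "a \<ge> 1"
    and Q_ge: "a * q \<le> Q" and Q_le: "Q \<le> (a + 1) * q"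
    and det: "P' * q - Q * P = 1"
    and below: "0 \<le> P' - Q * \<alpha>" and closer: "P' - Q * \<alpha> \<le> q * \<alpha> - P"
begin

definition gap :: real where "gap = q * \<alpha> - P"

text \<open>The s of the overview, with \<open>gap\<close> its delta: the representative of
  \<open>m * P\<close> modulo \<open>q\<close> for which \<open>offset m + m * gap\<close> is
  smallest in absolute value.\<close>

definition offset :: "int \<Rightarrow> int" where "offset m = m * P - round (m * \<alpha>) * q"

lemma Q_pos: "Q \<ge> q" "Q \<ge> a" "Q > 0"
proof -
  have "1 * q \<le> a * q" "a * 1 \<le> a * q"
    using q_pos a_pos by (intro mult_mono; simp)+
  then show "Q \<ge> q" "Q \<ge> a" "Q > 0"
    using Q_ge q_pos by linarith+
qed

lemma gap_identity: "Q * gap + q * (P' - Q * \<alpha>) = 1"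
proof -
  have "Q * gap + q * (P' - Q * \<alpha>) = of_int (P' * q - Q * P)"
    by (simp add: gap_def algebra_simps)
  then show ?thesis
    using det by simp
qed

text \<open>By \<open>below\<close> and \<open>closer\<close> the second summand in
  \<open>gap_identity\<close> lies between 0 and \<open>q * gap\<close>.\<close>

lemma gap_bounds: "Q * gap \<le> 1" "(Q + q) * gap \<ge> 1" "gap > 0"
proof -
  have "0 \<le> q * (P' - Q * \<alpha>)"
    using q_pos below by simp
  then show "Q * gap \<le> 1"
    using gap_identity by linarith
  have "q * (P' - Q * \<alpha>) \<le> q * gap"
    using q_pos closer by (intro mult_left_mono) (auto simp: gap_def)
  then show *: "(Q + q) * gap \<ge> 1"
    using gap_identity by (simp add: algebra_simps)
  have "real_of_int (Q + q) > 0"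
    using Q_pos q_pos by simp
  then show "gap > 0"
    using * by (smt (verit) mult_nonneg_nonpos)
qed

lemma q_gap_bounds: "a * (q * gap) \<le> 1" "(a + 2) * (q * gap) \<ge> 1"
proof -
  have "real_of_int (a * q) * gap \<le> Q * gap"
    using Q_ge gap_bounds(3) by (intro mult_right_mono) (simp_all only: of_int_le_iff less_imp_le)
  then show "a * (q * gap) \<le> 1"
    using gap_bounds(1) by (simp add: mult.assoc)
  have "Q + q \<le> (a + 2) * q"
    using Q_le by (simp add: algebra_simps)
  then have "(Q + q) * gap \<le> real_of_int ((a + 2) * q) * gap"
    using gap_bounds(3) by (intro mult_right_mono) (simp_all only: of_int_le_iff less_imp_le)
  then show "(a + 2) * (q * gap) \<ge> 1"
    using gap_bounds(2) by (simp add: mult.assoc)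
qed

lemma nearest_int_dist_eq: "nearest_int_dist (m * \<alpha>) = \<bar>offset m + m * gap\<bar> / q"
proof -
  have "q * (m * \<alpha> - round (m * \<alpha>)) = offset m + m * gap"
    by (simp add: offset_def gap_def algebra_simps)
  then have "m * \<alpha> - round (m * \<alpha>) = (offset m + m * gap) / q"
    using q_pos by (simp add: field_simps)
  then show ?thesis
    using q_pos by (simp add: nearest_int_dist_def)
qed

lemma coprime_q_P: "coprime q P"
proof (rule coprimeI)
  fix d assume "d dvd q" "d dvd P"
  then have "d dvd P' * q - Q * P"
    by simp
  then show "is_unit d"
    using det by simp
qed

text \<open>The offset is congruent to \<open>m * P\<close> modulo \<open>q\<close>, and
  \<open>P\<close> is invertible modulo \<open>q\<close>.\<close>

lemma dvd_diff_if_offset_eq: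
  assumes "offset m = offset n"
  shows "q dvd m - n"
proof -
  have "(m - n) * P = (round (m * \<alpha>) - round (n * \<alpha>)) * q"
    using assms by (simp add: offset_def algebra_simps)
  then have "q dvd (m - n) * P"
    by simp
  then show ?thesis
    using coprime_q_P by (simp add: coprime_dvd_mult_left_iff)
qed

text \<open>The offset fixes the residue of \<open>m\<close> modulo \<open>q\<close>. This supplies
  injectivity for the comparisons with zeta series.\<close>

lemma eq_if_div_offset_eq:
  assumes "m div q = n div q" "offset m = offset n"
  shows "m = n"
proof -
  have "m mod q = n mod q"
    using dvd_diff_if_offset_eq[OF assms(2)] by (simp add: mod_eq_dvd_iff)
  with assms(1) show ?thesis
    by (metis div_mult_mod_eq)
qed

lemma dvd_if_offset_0: "offset m = 0 \<Longrightarrow> q dvd m"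
  using dvd_diff_if_offset_eq[of m 0] by (simp add: offset_def)

text \<open>By \<open>det\<close>, \<open>Q * P\<close> is congruent to -1 modulo \<open>q\<close>,
  so \<open>m\<close> and \<open>Q\<close> lie in the same residue class.\<close>

lemma dvd_if_offset_minus_1:
  assumes "offset m = - 1"
  shows "q dvd Q - m"
proof -
  have "(Q - m) * P = (P' - round (m * \<alpha>)) * q"
    using assms det by (simp add: offset_def algebra_simps)
  then have "q dvd (Q - m) * P"
    by simp
  then show ?thesis
    using coprime_q_P by (simp add: coprime_dvd_mult_left_iff)
qed

text \<open>The perturbation of the integer \<open>offset m\<close> stays strictly between 0 and 1,
  so only the offsets 0 and -1 can come close to cancelling.\<close>

lemma m_gap_less_1: "0 < m * gap" "m * gap < 1" if "m \<in> {q..<Q}" for m :: int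
proof -
  show "0 < m * gap"
    using that q_pos gap_bounds by simp
  have "m * gap < Q * gap"
    using that gap_bounds(3) by simp
  then show "m * gap < 1"
    using gap_bounds(1) by simp
qed

section \<open>Lower bounds for m times the distance, by offset\<close>

lemma div_q_pos: "m div q > 0" "(m div q) * q \<le> m" if "m \<in> {q..<Q}"
  using that q_pos by (auto simp: pos_imp_zdiv_pos_iff) (smt (verit) minus_div_mult_eq_mod pos_mod_sign)

text \<open>The perturbation only increases the distance, and the denominator \<open>q\<close>
  cancels against \<open>(m div q) * q \<le> m\<close>.\<close>

lemma mult_dist_ge_if_offset_pos:
  assumes "m \<in> {q..<Q}" "offset m > 0"
  shows "(m div q) * offset m \<le> m * nearest_int_dist (m * \<alpha>)"
proof -
  have "real_of_int (offset m) / q \<le> nearest_int_dist (m * \<alpha>)"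
    unfolding nearest_int_dist_eq using assms q_pos m_gap_less_1[of m]
    by (intro divide_right_mono) auto
  moreover have "real_of_int ((m div q) * q) \<le> m"
    using div_q_pos(2)[OF assms(1)] by (simp only: of_int_le_iff)
  ultimately have "real_of_int ((m div q) * q) * (offset m / q) \<le> m * nearest_int_dist (m * \<alpha>)"
    using assms q_pos by (intro mult_mono) (auto simp: nearest_int_dist_def)
  then show ?thesis
    using q_pos by simp
qed

text \<open>Here the perturbation works against the offset and may cost up to 1.\<close>

lemma mult_dist_ge_if_offset_neg:
  assumes "m \<in> {q..<Q}" "offset m < - 1"
  shows "(m div q) * (- offset m - 1) \<le> m * nearest_int_dist (m * \<alpha>)"
proof -
  have "real_of_int (- offset m - 1) / q \<le> nearest_int_dist (m * \<alpha>)"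
    unfolding nearest_int_dist_eq using assms q_pos m_gap_less_1[of m]
    by (intro divide_right_mono) auto
  moreover have "real_of_int ((m div q) * q) \<le> m"
    using div_q_pos(2)[OF assms(1)] by (simp only: of_int_le_iff)
  ultimately have "real_of_int ((m div q) * q) * (real_of_int (- offset m - 1) / q) \<le>
      m * nearest_int_dist (m * \<alpha>)"
    using assms q_pos by (intro mult_mono) (auto simp: nearest_int_dist_def)
  then show ?thesis
    using q_pos by simp
qed

text \<open>Write Q = m + i q. From Q gap \<le> 1 follows 1 - m gap \<ge> i q / Q, so the distance
  is at least i / Q. The larger of the summands m and i q is at least Q / 2, which bounds m i / Q
  below by i / 2 or by m / (2 q).\<close>

lemma mult_dist_ge_if_offset_minus_1:
  assumes m: "m \<in> {q..<Q}" and "offset m = - 1"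
  shows "min ((Q - m) div q) (m div q) / 2 \<le> m * nearest_int_dist (m * \<alpha>)"
proof -
  define i where "i = (Q - m) div q"
  have i: "Q - m = i * q"
    using dvd_if_offset_minus_1[OF assms(2)] by (simp add: i_def)
  then have Q: "real_of_int Q = m + i * q"
    by (metis add.commute diff_add_cancel of_int_add of_int_mult)
  have "i > 0"
    using i m q_pos by (smt (verit) atLeastLessThan_iff mult_nonpos_nonneg)
  have pos: "real_of_int m > 0" "real_of_int q > 0" "real_of_int Q > 0" "real_of_int i > 0"
    using m q_pos \<open>i > 0\<close> by auto
  have "m * gap \<le> m / Q"
    using gap_bounds(1) pos by (simp add: field_simps)
  then have "(1 - m / Q) / q \<le> nearest_int_dist (m * \<alpha>)"
    unfolding nearest_int_dist_eq using assms q_pos m_gap_less_1[of m]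
    by (intro divide_right_mono) auto
  moreover have "(1 - m / Q) / q = i / Q"
  proof -
    have "1 - m / Q = i * q / Q"
      using pos Q by (simp add: diff_divide_eq_iff)
    then show ?thesis
      using pos by simp
  qed
  ultimately have *: "m * (i / Q) \<le> m * nearest_int_dist (m * \<alpha>)"
    using pos by (intro mult_left_mono) auto
  show ?thesis
  proof (cases "real_of_int m \<ge> i * q")
    case True
    then have "real_of_int i * Q \<le> real_of_int i * (2 * real_of_int m)"
      using pos by (intro mult_left_mono) (auto simp: Q)
    then have "i / 2 \<le> m * (i / Q)"
      using pos by (simp add: field_simps)
    moreover have "real_of_int (min i (m div q)) \<le> i"
      by simp
    ultimately show ?thesis
      using * unfolding i_def[symmetric] by linarith
  next
    case False
    then have "real_of_int m * Q \<le> real_of_int m * (2 * (real_of_int i * real_of_int q))"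
      using pos by (intro mult_left_mono) (auto simp: Q)
    then have "m / q / 2 \<le> m * (i / Q)"
      using pos by (simp add: field_simps)
    moreover have "real_of_int (min i (m div q)) / 2 \<le> m / q / 2"
      by (intro divide_right_mono order.trans[OF _ real_of_int_div4]) auto
    ultimately show ?thesis
      using * unfolding i_def[symmetric] by (meson order.trans)
  qed
qed

section \<open>Sums over a block, grouped by offset\<close>

definition block_term :: "real \<Rightarrow> int \<Rightarrow> real"
  where "block_term p m = 1 / (real_of_int m powr p * nearest_int_dist (real_of_int m * \<alpha>) powr p)"

lemma block_term_nonneg [simp]: "block_term p m \<ge> 0"
  by (simp add: block_term_def)

lemma block_term_le:
  assumes "c > 0" "c \<le> m * nearest_int_dist (m * \<alpha>)" "p > 1"
  shows "block_term p m \<le> 1 / c powr p"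
  unfolding block_term_def using assms by (intro inverse_powr_mult_le) auto

lemma sum_offset_pos_le:
  assumes "p > 1"
  shows "(\<Sum>m | m \<in> {q..<Q} \<and> offset m > 0. block_term p m) \<le> (zeta_real p)\<^sup>2"
proof -
  let ?A = "{m. m \<in> {q..<Q} \<and> offset m > 0}"
  have fin: "finite ?A"
    by (rule finite_subset[of _ "{q..<Q}"]) auto
  have inj: "inj_on (\<lambda>m. (m div q, offset m)) ?A"
    by (rule inj_onI, rule eq_if_div_offset_eq) auto
  have "(\<Sum>m\<in>?A. block_term p m) \<le> (\<Sum>m\<in>?A. 1 / (real_of_int (m div q) * real_of_int (offset m)) powr p)"
    using mult_dist_ge_if_offset_pos div_q_pos assms
    by (intro sum_mono block_term_le) auto
  also have "\<dots> \<le> (zeta_real p)\<^sup>2"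
    using div_q_pos assms fin inj
    by (intro sum_inverse_powr_mult_le_zeta_squared) auto
  finally show ?thesis .
qed

lemma sum_offset_neg_le:
  assumes "p > 1"
  shows "(\<Sum>m | m \<in> {q..<Q} \<and> offset m < - 1. block_term p m) \<le> (zeta_real p)\<^sup>2"
proof -
  let ?A = "{m. m \<in> {q..<Q} \<and> offset m < - 1}"
  have fin: "finite ?A"
    by (rule finite_subset[of _ "{q..<Q}"]) auto
  have inj: "inj_on (\<lambda>m. (m div q, - offset m - 1)) ?A"
    by (rule inj_onI, rule eq_if_div_offset_eq) auto
  have "(\<Sum>m\<in>?A. block_term p m) \<le>
      (\<Sum>m\<in>?A. 1 / (real_of_int (m div q) * real_of_int (- offset m - 1)) powr p)"
    using mult_dist_ge_if_offset_neg div_q_pos assms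
    by (intro sum_mono block_term_le) auto
  also have "\<dots> \<le> (zeta_real p)\<^sup>2"
    using div_q_pos assms fin inj
    by (intro sum_inverse_powr_mult_le_zeta_squared) auto
  finally show ?thesis .
qed

text \<open>For this fixed offset \<open>m\<close> is determined by \<open>m div q\<close> alone and
  also by \<open>(Q - m) div q\<close> alone, so each index contributes at most one zeta
  series.\<close>

lemma sum_offset_minus_1_le:
  assumes "p > 1"
  shows "(\<Sum>m | m \<in> {q..<Q} \<and> offset m = - 1. block_term p m) \<le> 2 powr p * (2 * zeta_real p)"
proof -
  let ?A = "{m. m \<in> {q..<Q} \<and> offset m = - 1}"
  have fin: "finite ?A"
    by (rule finite_subset[of _ "{q..<Q}"]) auto
  have eq: "Q - m = ((Q - m) div q) * q" if "m \<in> ?A" for m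
    using dvd_if_offset_minus_1[of m] that by simp
  have pos: "(Q - m) div q > 0" if "m \<in> ?A" for m
  proof -
    have "((Q - m) div q) * q > 0"
      using eq[OF that] that by simp
    then show ?thesis
      using q_pos by (simp add: zero_less_mult_iff)
  qed
  have inj1: "inj_on (\<lambda>m. (Q - m) div q) ?A"
  proof (rule inj_onI)
    fix m n assume "m \<in> ?A" "n \<in> ?A" "(Q - m) div q = (Q - n) div q"
    then have "Q - m = Q - n"
      using eq[of m] eq[of n] by simp
    then show "m = n"
      by simp
  qed
  have inj2: "inj_on (\<lambda>m. m div q) ?A"
    by (rule inj_onI, rule eq_if_div_offset_eq) auto
  have "block_term p m \<le> 2 powr p * (1 / ((Q - m) div q) powr p + 1 / (m div q) powr p)"
    if m: "m \<in> ?A" for m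
  proof -
    let ?i = "(Q - m) div q" and ?j = "m div q"
    have "?j > 0"
      using m div_q_pos by auto
    have "block_term p m \<le> 1 / (min ?i ?j / 2) powr p"
      using mult_dist_ge_if_offset_minus_1[of m] pos[OF m] \<open>?j > 0\<close> m assms
      by (intro block_term_le) (auto simp: min_def)
    also have "\<dots> = 2 powr p * (1 / (min ?i ?j) powr p)"
      by (simp add: powr_divide)
    \<comment> \<open>The minimum is one of the two numbers, and both reciprocal powers are
      nonnegative.\<close>
    also have "1 / (min ?i ?j) powr p \<le> 1 / ?i powr p + 1 / ?j powr p"
      by (simp add: min_def)
    finally show ?thesis
      by simp
  qed
  then have "(\<Sum>m\<in>?A. block_term p m) \<le>
      (\<Sum>m\<in>?A. 2 powr p * (1 / ((Q - m) div q) powr p + 1 / (m div q) powr p))"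
    by (intro sum_mono)
  also have "\<dots> = 2 powr p * ((\<Sum>m\<in>?A. 1 / ((Q - m) div q) powr p) + (\<Sum>m\<in>?A. 1 / (m div q) powr p))"
    by (simp only: sum.distrib flip: sum_distrib_left)
  also have "\<dots> \<le> 2 powr p * (zeta_real p + zeta_real p)"
    using assms fin inj1 inj2 pos div_q_pos
    by (intro mult_left_mono add_mono sum_inverse_powr_le_zeta) auto
  finally show ?thesis
    by simp
qed

lemma sum_offset_nonzero_le:
  assumes "p > 1"
  shows "(\<Sum>m | m \<in> {q..<Q} \<and> offset m \<noteq> 0. block_term p m) \<le> 4 * 2 powr p * (zeta_real p)\<^sup>2"
proof -
  let ?A = "\<lambda>R. {m. m \<in> {q..<Q} \<and> R (offset m)}"
  have fin: "finite (?A R)" for R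
    by (rule finite_subset[of _ "{q..<Q}"]) auto
  have "?A (\<lambda>s. s \<noteq> 0) = (?A (\<lambda>s. s > 0) \<union> ?A (\<lambda>s. s < - 1)) \<union> ?A (\<lambda>s. s = - 1)"
    by auto
  moreover have "sum (block_term p) ((?A (\<lambda>s. s > 0) \<union> ?A (\<lambda>s. s < - 1)) \<union> ?A (\<lambda>s. s = - 1)) =
      sum (block_term p) (?A (\<lambda>s. s > 0) \<union> ?A (\<lambda>s. s < - 1)) + sum (block_term p) (?A (\<lambda>s. s = - 1))"
    using fin by (intro sum.union_disjoint finite_UnI) auto
  moreover have "sum (block_term p) (?A (\<lambda>s. s > 0) \<union> ?A (\<lambda>s. s < - 1)) =
      sum (block_term p) (?A (\<lambda>s. s > 0)) + sum (block_term p) (?A (\<lambda>s. s < - 1))"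
    using fin by (intro sum.union_disjoint) auto
  ultimately have "sum (block_term p) (?A (\<lambda>s. s \<noteq> 0)) = sum (block_term p) (?A (\<lambda>s. s > 0)) +
      sum (block_term p) (?A (\<lambda>s. s < - 1)) + sum (block_term p) (?A (\<lambda>s. s = - 1))"
    by (simp only:)
  also have "\<dots> \<le> (zeta_real p)\<^sup>2 + (zeta_real p)\<^sup>2 + 2 powr p * (2 * zeta_real p)"
    by (intro add_mono sum_offset_pos_le sum_offset_neg_le sum_offset_minus_1_le assms)
  \<comment> \<open>Both zeta(p) and 2^p are at least 1, so everything is absorbed into one multiple
    of the square.\<close>
  also have "\<dots> \<le> 4 * 2 powr p * (zeta_real p)\<^sup>2"
  proof -
    have z: "zeta_real p \<le> (zeta_real p)\<^sup>2"
      using zeta_real_ge_1[OF assms] by (simp add: power2_eq_square)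
    have "1 * (zeta_real p)\<^sup>2 \<le> 2 powr p * (zeta_real p)\<^sup>2"
      using assms by (intro mult_right_mono ge_one_powr_ge_zero) auto
    moreover have "2 powr p * zeta_real p \<le> 2 powr p * (zeta_real p)\<^sup>2"
      using z by simp
    ultimately show ?thesis
      by linarith
  qed
  finally show ?thesis .
qed

text \<open>At m = j q with offset 0 the distance is j gap, so the product is j^2 (q gap). The
  square is the source of zeta(2p).\<close>

lemma block_term_multiple:
  assumes "offset (j * q) = 0" "j > 0"
  shows "block_term p (j * q) = (1 / (q * gap)) powr p * (1 / j powr (2 * p))"
proof -
  have "real_of_int (j * q) * nearest_int_dist (real_of_int (j * q) * \<alpha>) = (j * j) * (q * gap)"
    using assms q_pos gap_bounds(3) nearest_int_dist_eq[of "j * q"] by simp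
  then have "block_term p (j * q) = 1 / ((j * j) * (q * gap)) powr p"
    by (simp only: block_term_def powr_mult[symmetric])
  then show ?thesis
    by (simp add: powr_mult powr_divide powr_add[symmetric])
qed

lemma sum_offset_0_le:
  assumes "p > 1"
  shows "(\<Sum>m | m \<in> {q..<Q} \<and> offset m = 0. block_term p m) \<le> (a + 2) powr p * zeta_real (2 * p)"
proof -
  let ?A = "{m. m \<in> {q..<Q} \<and> offset m = 0}"
  have fin: "finite ?A"
    by (rule finite_subset[of _ "{q..<Q}"]) auto
  have inj: "inj_on (\<lambda>m. m div q) ?A"
    by (rule inj_onI, rule eq_if_div_offset_eq) auto
  have "1 / (q * gap) \<le> a + 2"
    using q_gap_bounds(2) q_pos gap_bounds(3) by (simp add: divide_le_eq)
  then have le: "(1 / (q * gap)) powr p \<le> (a + 2) powr p"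
    using assms q_pos gap_bounds(3) by (intro powr_mono2) auto
  have "(\<Sum>m\<in>?A. block_term p m) = (\<Sum>m\<in>?A. (1 / (q * gap)) powr p * (1 / (m div q) powr (2 * p)))"
  proof (rule sum.cong)
    fix m assume m: "m \<in> ?A"
    then have "m = (m div q) * q" "m div q > 0"
      using dvd_if_offset_0[of m] div_q_pos[of m] by auto
    then show "block_term p m = (1 / (q * gap)) powr p * (1 / (m div q) powr (2 * p))"
      using block_term_multiple[of "m div q" p] m by simp
  qed simp
  also have "\<dots> = (1 / (q * gap)) powr p * (\<Sum>m\<in>?A. 1 / (m div q) powr (2 * p))"
    by (simp add: sum_distrib_left)
  also have "\<dots> \<le> (a + 2) powr p * zeta_real (2 * p)"
    using assms fin inj div_q_pos le
    by (intro mult_mono sum_inverse_powr_le_zeta sum_nonneg) auto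
  finally show ?thesis .
qed

text \<open>Since a \<le> Q \<le> 1 / gap, the condition 2 j < a gives j gap < 1/2, so
  \<open>j * P\<close> is the integer nearest to j q \<alpha>.\<close>

lemma offset_multiple_0:
  assumes "0 < j" "2 * j < a"
  shows "offset (j * q) = 0" "j * q \<in> {q..<Q}"
proof -
  have "1 * q \<le> j * q" "j * q < a * q"
    using assms q_pos by (auto intro: mult_right_mono)
  then show "j * q \<in> {q..<Q}"
    using Q_ge by auto
  have "2 * j * gap < a * gap"
    using assms gap_bounds(3) by (intro mult_strict_right_mono) linarith+
  also have "\<dots> \<le> Q * gap"
    using Q_pos gap_bounds(3) by simp
  finally have "2 * j * gap < 1"
    using gap_bounds(1) by simp
  moreover have "j * gap > 0"
    using assms gap_bounds(3) by simp
  moreover have "real_of_int (j * q) * \<alpha> - of_int (j * P) = j * gap"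
    by (simp add: gap_def algebra_simps)
  ultimately have "round (real_of_int (j * q) * \<alpha>) = j * P"
    by (intro round_unique') linarith
  then show "offset (j * q) = 0"
    by (simp add: offset_def)
qed

text \<open>The full series for zeta(2p) is split at 2 j = a: smaller j give terms that occur in the
  block, and for the others a \<le> 2 j trades a^p / j^(2p) for 2^p / j^p.\<close>

lemma sum_offset_0_ge:
  assumes "p > 1"
  shows "a powr p * zeta_real (2 * p) \<le>
    (\<Sum>m | m \<in> {q..<Q} \<and> offset m = 0. block_term p m) + 2 powr p * zeta_real p"
proof -
  let ?A = "{m. m \<in> {q..<Q} \<and> offset m = 0}"
  define S where "S = (\<Sum>m\<in>?A. block_term p m)"
  have finA: "finite ?A"
    by (rule finite_subset[of _ "{q..<Q}"]) auto
  define g where "g n = a powr p * (1 / real (Suc n) powr (2 * p))" for n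
  have summ: "summable g"
    unfolding g_def using assms by (intro summable_mult summable_zeta_real) auto
  have tail: "g n \<le> 2 powr p * (1 / real (Suc n) powr p)" if "\<not> 2 * int (Suc n) < a" for n
  proof -
    have "real_of_int a \<le> 2 * real (Suc n)"
      using that by linarith
    then have "a powr p \<le> (2 * real (Suc n)) powr p"
      using assms a_pos by (intro powr_mono2) auto
    then have "g n \<le> (2 * real (Suc n)) powr p * (1 / real (Suc n) powr (2 * p))"
      unfolding g_def by (intro mult_right_mono) auto
    also have "\<dots> = 2 powr p * (1 / real (Suc n) powr p)"
    proof -
      have "(2 * x) powr p * (1 / x powr (2 * p)) = 2 powr p * (1 / x powr p)" if "x > 0" for x :: real
        using that powr_add[of x p p] by (simp add: powr_mult)
      from this[of "real (Suc n)"] show ?thesis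
        by (simp only: of_nat_0_less_iff zero_less_Suc)
    qed
    finally show ?thesis .
  qed
  have "sum g {..<M} \<le> S + 2 powr p * zeta_real p" for M
  proof -
    \<comment> \<open>The series index n stands for the multiple j = n + 1.\<close>
    define J where "J = {n\<in>{..<M}. 2 * int (Suc n) < a}"
    have "sum g {..<M} = sum g J + sum g ({..<M} - J)"
      by (subst add.commute, rule sum.subset_diff) (auto simp: J_def)
    also have "sum g J \<le> S"
    proof -
      have "g n \<le> block_term p (int (Suc n) * q)" if "n \<in> J" for n
      proof -
        have "a \<le> 1 / (q * gap)"
          using q_gap_bounds(1) q_pos gap_bounds(3) by (simp add: le_divide_eq)
        then have "a powr p \<le> (1 / (q * gap)) powr p"
          using assms a_pos by (intro powr_mono2) auto
        moreover have "offset (int (Suc n) * q) = 0"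
          using that by (intro offset_multiple_0) (auto simp: J_def)
        ultimately show ?thesis
          unfolding g_def using block_term_multiple[of "int (Suc n)" p]
          by (simp add: divide_right_mono)
      qed
      then have "sum g J \<le> (\<Sum>n\<in>J. block_term p (int (Suc n) * q))"
        by (intro sum_mono)
      also have "\<dots> = sum (block_term p) ((\<lambda>n. int (Suc n) * q) ` J)"
        using q_pos by (subst sum.reindex) (auto simp: inj_on_def)
      also have "\<dots> \<le> S"
        unfolding S_def using finA offset_multiple_0
        by (intro sum_mono2) (auto simp: J_def simp del: of_nat_Suc)
      finally show ?thesis .
    qed
    also have "sum g ({..<M} - J) \<le> (\<Sum>n\<in>{..<M} - J. 2 powr p * (1 / real (Suc n) powr p))"
      using tail by (intro sum_mono) (auto simp: J_def)
    also have "\<dots> = 2 powr p * (\<Sum>n\<in>{..<M} - J. 1 / real (Suc n) powr p)"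
      by (simp add: sum_distrib_left)
    also have "\<dots> \<le> 2 powr p * zeta_real p"
      unfolding zeta_real_def using assms
      by (intro mult_left_mono sum_le_suminf summable_zeta_real) auto
    finally show ?thesis
      by simp
  qed
  then have "suminf g \<le> S + 2 powr p * zeta_real p"
    by (intro suminf_le_const summ)
  moreover have "suminf g = a powr p * zeta_real (2 * p)"
    unfolding g_def zeta_real_def using assms
    by (intro suminf_mult summable_zeta_real) auto
  ultimately show ?thesis
    by (simp add: S_def)
qed

lemma block_norm_estimate:
  assumes "p > 1"
  shows "\<bar>(\<Sum>m\<in>{q..<Q}. block_term p m) powr (1 / p) - zeta_real (2 * p) powr (1 / p) * a\<bar>
    \<le> 6 powr p * (4 * p\<^sup>2 / (p - 1)\<^sup>2)"
proof -
  define Z where "Z = zeta_real p"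
  define Z2 where "Z2 = zeta_real (2 * p) powr (1 / p)"
  define S where "S = (\<Sum>m | m \<in> {q..<Q} \<and> offset m = 0. block_term p m)"
  define T where "T = (\<Sum>m | m \<in> {q..<Q} \<and> offset m \<noteq> 0. block_term p m)"
  have "{q..<Q} = {m. m \<in> {q..<Q} \<and> offset m = 0} \<union> {m. m \<in> {q..<Q} \<and> offset m \<noteq> 0}"
    by auto
  also have "sum (block_term p) \<dots> = S + T"
    unfolding S_def T_def by (rule sum.union_disjoint) (auto intro: finite_subset[of _ "{q..<Q}"])
  finally have ST: "(\<Sum>m\<in>{q..<Q}. block_term p m) = S + T" .
  have nonneg: "S \<ge> 0" "T \<ge> 0"
    by (auto simp: S_def T_def intro!: sum_nonneg)
  have Z: "Z \<ge> 1" "Z \<le> Z\<^sup>2"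
    using zeta_real_ge_1[OF assms] by (auto simp: Z_def power2_eq_square)
  have z2: "1 \<le> zeta_real (2 * p)" "zeta_real (2 * p) \<le> Z"
    using assms zeta_real_ge_1 zeta_real_antimono by (auto simp: Z_def)
  have Z2: "Z2 \<le> Z"
    unfolding Z2_def using z2 assms by (intro powr_root_le_self) auto
  have two: "2 powr p \<ge> 1"
    using assms by (intro ge_one_powr_ge_zero) auto
  have a: "real_of_int a \<ge> 1"
    using a_pos by simp
  have "S powr (1 / p) \<le> ((a + 2) powr p * zeta_real (2 * p)) powr (1 / p)"
    unfolding S_def using sum_offset_0_le[OF assms] assms
    by (intro powr_root_mono) (auto intro!: sum_nonneg)
  also have "\<dots> = (a + 2) * Z2"
    using assms a by (simp add: powr_mult powr_powr Z2_def)
  finally have S_le: "S powr (1 / p) \<le> Z2 * a + 2 * Z"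
    using Z2 by (simp add: algebra_simps)
  have "T \<le> 4 * 2 powr p * Z\<^sup>2"
    using sum_offset_nonzero_le[OF assms] by (simp add: T_def Z_def)
  \<comment> \<open>A bound that is at least 1 may replace its own p-th root.\<close>
  moreover have "1 * 1 \<le> 4 * 2 powr p * Z\<^sup>2"
    using two Z by (intro mult_mono) auto
  ultimately have T_le: "T powr (1 / p) \<le> 4 * 2 powr p * Z\<^sup>2"
    using nonneg assms by (intro powr_root_le_self) auto
  have "Z2 * a = (a powr p * zeta_real (2 * p)) powr (1 / p)"
    using assms a by (simp add: powr_mult powr_powr Z2_def)
  also have "\<dots> \<le> (S + 2 powr p * Z) powr (1 / p)"
    using sum_offset_0_ge[OF assms] assms z2
    by (intro powr_root_mono) (auto simp: S_def Z_def)
  also have "\<dots> \<le> S powr (1 / p) + (2 powr p * Z) powr (1 / p)"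
    using nonneg Z assms by (intro powr_root_add_le) auto
  also have "(2 powr p * Z) powr (1 / p) = 2 * Z powr (1 / p)"
    using assms by (simp add: powr_mult powr_powr)
  also have "Z powr (1 / p) \<le> Z"
    using Z assms by (intro powr_root_le_self) auto
  finally have S_ge: "Z2 * a \<le> S powr (1 / p) + 2 * Z"
    by simp
  have "(S + T) powr (1 / p) \<le> Z2 * a + 2 * Z + 4 * 2 powr p * Z\<^sup>2"
    using powr_root_add_le[of p S T] S_le T_le nonneg assms by simp
  moreover have "S powr (1 / p) \<le> (S + T) powr (1 / p)"
    using nonneg assms by (intro powr_root_mono) auto
  moreover have "0 \<le> 4 * 2 powr p * Z\<^sup>2"
    by simp
  ultimately have "\<bar>(S + T) powr (1 / p) - Z2 * a\<bar> \<le> 2 * Z + 4 * 2 powr p * Z\<^sup>2"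
    using S_ge by linarith
  also have "\<dots> \<le> (2 + 4 * 2 powr p) * Z\<^sup>2"
    using Z by (simp add: algebra_simps)
  \<comment> \<open>Since 2^p \<ge> 1 and 3^p \<ge> 3, one has 2 + 4 2^p \<le> 6 2^p \<le> 2 6^p;
    the square comes from zeta(p) \<le> p / (p-1).\<close>
  also have "\<dots> \<le> (4 * 6 powr p) * (p / (p - 1))\<^sup>2"
  proof (intro mult_mono power_mono)
    have "3 powr 1 \<le> 3 powr p"
      using assms by (intro powr_mono) auto
    then have "2 powr p * 3 \<le> 2 powr p * 3 powr p"
      by simp
    also have "\<dots> = 6 powr p"
      by (simp flip: powr_mult)
    finally show "2 + 4 * 2 powr p \<le> 4 * 6 powr p"
      using two by linarith
    show "Z \<le> p / (p - 1)"
      using zeta_real_le[OF assms] by (simp add: Z_def)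
  qed (use Z in auto)
  also have "\<dots> = 6 powr p * (4 * p\<^sup>2 / (p - 1)\<^sup>2)"
    by (simp add: power_divide)
  finally show ?thesis
    unfolding ST Z2_def .
qed

end

subsection \<open>Continued fractions\<close>

text \<open>The sign compensates for the convergents lying alternately below and above the number;
  index 1, the convergent \<open>a 0\<close>, gets the positive sign.\<close>

definition cf_error :: "(nat \<Rightarrow> int) \<Rightarrow> real \<Rightarrow> nat \<Rightarrow> real"
  where "cf_error a x k = (- 1) ^ Suc k * (real_of_int (cf_den a k) * x - real_of_int (cf_num a k))"

lemma cf_error_rec: "cf_error a x k = a (Suc k) * cf_error a x (Suc k) + cf_error a x (Suc (Suc k))"
  by (simp add: cf_error_def algebra_simps)

text \<open>Downward induction: the error at n is 0, the one before it is 1 /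
  \<open>cf_den a n\<close> by the determinant relation, and \<open>cf_error_rec\<close> has only
  nonnegative terms when read backwards.\<close>

lemma cf_error_convergent_antimono:
  assumes pos: "\<And>i. 0 < i \<Longrightarrow> i < n \<Longrightarrow> a i \<ge> 1" and "k < n"
  shows "0 \<le> cf_error a (cf_convergent a n) (Suc k) \<and>
    cf_error a (cf_convergent a n) (Suc k) \<le> cf_error a (cf_convergent a n) k"
proof -
  let ?e = "cf_error a (cf_convergent a n)"
  obtain l where n: "n = Suc l"
    using \<open>k < n\<close> by (cases n) auto
  have den: "cf_den a n \<ge> 1"
    using cf_den_pos[of n a] pos n by auto
  have x: "cf_convergent a n = real_of_int (cf_num a n) / real_of_int (cf_den a n)"
    using pos n by (intro cf_convergent_eq) auto
  have "k \<le> l"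
    using \<open>k < n\<close> n by simp
  then show ?thesis
  proof (induction rule: inc_induct)
    case base
    have "?e n = 0"
      using den by (simp add: cf_error_def x)
    moreover have "?e l = (- 1) ^ Suc l *
        of_int (cf_num a (Suc l) * cf_den a l - cf_num a l * cf_den a (Suc l)) / cf_den a n"
      using den by (simp add: cf_error_def x[unfolded n] n field_simps del: cf_num.simps cf_den.simps)
    then have "?e l = 1 / cf_den a n"
      unfolding cf_num_den_det by (simp flip: power_mult_distrib)
    ultimately show ?case
      using den n by simp
  next
    case (step j)
    have "a (Suc j) \<ge> 1"
      using step n by (intro pos) auto
    then have "1 * ?e (Suc j) \<le> a (Suc j) * ?e (Suc j)"
      using step by (intro mult_right_mono) auto
    then show ?case
      using step cf_error_rec[of a "cf_convergent a n" j] by simp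
  qed
qed

lemma cf_error_antimono:
  assumes "cf_expansion a N \<alpha>" "enat k < N"
  shows "0 \<le> cf_error a \<alpha> (Suc k)" "cf_error a \<alpha> (Suc k) \<le> cf_error a \<alpha> k"
proof -
  have pos: "a i \<ge> 1" if "0 < i" "enat i < N" for i
    using assms that by (auto simp: cf_expansion_def)
  have "0 \<le> cf_error a \<alpha> (Suc k) \<and> cf_error a \<alpha> (Suc k) \<le> cf_error a \<alpha> k"
  proof (cases N)
    case (enat n)
    then have "\<alpha> = cf_convergent a n"
      using assms by (simp add: cf_expansion_def)
    then show ?thesis
      using cf_error_convergent_antimono[of n a k] pos assms enat by simp
  next
    case infinity
    then have "cf_convergent a \<longlonglongrightarrow> \<alpha>"
      using assms by (simp add: cf_expansion_def)
    \<comment> \<open>For a fixed index the error is continuous in the number, so the inequalities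
      for the convergents pass to the limit.\<close>
    then have lim: "(\<lambda>n. cf_error a (cf_convergent a n) j) \<longlonglongrightarrow> cf_error a \<alpha> j" for j
      unfolding cf_error_def by (intro tendsto_intros)
    have *: "0 \<le> cf_error a (cf_convergent a n) (Suc k)"
      "cf_error a (cf_convergent a n) (Suc k) \<le> cf_error a (cf_convergent a n) k" if "n \<ge> Suc k" for n
      using cf_error_convergent_antimono[of n a k] pos infinity that by auto
    have "0 \<le> cf_error a \<alpha> (Suc k)"
      using * by (intro LIMSEQ_le_const[OF lim]) blast
    moreover have "cf_error a \<alpha> (Suc k) \<le> cf_error a \<alpha> k"
      using * by (intro LIMSEQ_le[OF lim lim]) blast
    ultimately show ?thesis ..
  qed
  then show "0 \<le> cf_error a \<alpha> (Suc k)" "cf_error a \<alpha> (Suc k) \<le> cf_error a \<alpha> k"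
    by auto
qed

lemma cf_den_mono:
  assumes "\<And>i. 0 < i \<Longrightarrow> i \<le> k \<Longrightarrow> a i \<ge> 1"
  shows "cf_den a k \<le> cf_den a (Suc k)"
proof (cases k)
  case (Suc j)
  have "cf_den a j \<ge> 0" "cf_den a k \<ge> 1" "a k \<ge> 1"
    using cf_den_pos[of j a] cf_den_pos[of k a] assms Suc by auto
  moreover from this have "1 * cf_den a k \<le> a k * cf_den a k"
    by (intro mult_right_mono) auto
  moreover have "cf_den a (Suc k) = a k * cf_den a k + cf_den a j"
    using Suc by simp
  ultimately show ?thesis
    by linarith
qed simp

text \<open>The sign moves convergent k below the number; \<open>det\<close> is then
  \<open>cf_num_den_det\<close>, while \<open>below\<close> and \<open>closer\<close> are
  \<open>cf_error_antimono\<close>.\<close>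

lemma consecutive_convergents_cf:
  assumes exp: "cf_expansion a N \<alpha>" and "enat k < N" "k > 0"
  shows "consecutive_convergents ((- 1) ^ Suc k * \<alpha>) (cf_den a k) (cf_den a (Suc k))
    ((- 1) ^ Suc k * cf_num a k) ((- 1) ^ Suc k * cf_num a (Suc k)) (a k)"
proof -
  have pos: "a i \<ge> 1" if "0 < i" "i \<le> k" for i
  proof -
    have "enat i < N"
      using that \<open>enat k < N\<close> by (meson enat_ord_simps(1) le_less_trans)
    then show ?thesis
      using exp that by (auto simp: cf_expansion_def)
  qed
  obtain j where k: "k = Suc j"
    using \<open>k > 0\<close> by (cases k) auto
  have den: "cf_den a j \<ge> 0" "cf_den a j \<le> cf_den a k"
    using cf_den_pos[of j a] cf_den_mono[of j a] pos k by auto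
  have err: "0 \<le> cf_error a \<alpha> (Suc k)" "cf_error a \<alpha> (Suc k) \<le> cf_error a \<alpha> k"
    using cf_error_antimono assms by auto
  show ?thesis
  proof
    show "cf_den a k \<ge> 1"
      using cf_den_pos[of k a] pos k by auto
    show "a k \<ge> 1"
      using pos k by simp
    show "a k * cf_den a k \<le> cf_den a (Suc k)" "cf_den a (Suc k) \<le> (a k + 1) * cf_den a k"
      using den by (auto simp: k algebra_simps)
    have "(- 1) ^ Suc k * cf_num a (Suc k) * cf_den a k - cf_den a (Suc k) * ((- 1) ^ Suc k * cf_num a k)
        = (- 1) ^ Suc k * (cf_num a (Suc k) * cf_den a k - cf_num a k * cf_den a (Suc k))"
      by (simp add: algebra_simps)
    also have "\<dots> = 1"
      unfolding cf_num_den_det by (simp flip: power_mult_distrib)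
    finally show "(- 1) ^ Suc k * cf_num a (Suc k) * cf_den a k -
      cf_den a (Suc k) * ((- 1) ^ Suc k * cf_num a k) = 1" .
    have "cf_error a \<alpha> (Suc k) = real_of_int ((- 1) ^ Suc k * cf_num a (Suc k)) -
        real_of_int (cf_den a (Suc k)) * ((- 1) ^ Suc k * \<alpha>)"
      unfolding cf_error_def by (simp add: algebra_simps del: cf_num.simps cf_den.simps)
    moreover have "cf_error a \<alpha> k = real_of_int (cf_den a k) * ((- 1) ^ Suc k * \<alpha>) -
        real_of_int ((- 1) ^ Suc k * cf_num a k)"
      unfolding cf_error_def by (simp add: algebra_simps)
    ultimately show "0 \<le> real_of_int ((- 1) ^ Suc k * cf_num a (Suc k)) -
        real_of_int (cf_den a (Suc k)) * ((- 1) ^ Suc k * \<alpha>)"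
      "real_of_int ((- 1) ^ Suc k * cf_num a (Suc k)) -
        real_of_int (cf_den a (Suc k)) * ((- 1) ^ Suc k * \<alpha>) \<le>
        real_of_int (cf_den a k) * ((- 1) ^ Suc k * \<alpha>) - real_of_int ((- 1) ^ Suc k * cf_num a k)"
      using err by simp_all
  qed
qed

text \<open>The denominators start at 1 and never decrease, so the blocks tile the range; the block
  at k = 1 is empty if \<open>a 1\<close> is 1.\<close>

lemma sum_cf_den_blocks:
  fixes f :: "int \<Rightarrow> real"
  assumes "l > 0" "\<And>i. 0 < i \<Longrightarrow> i < l \<Longrightarrow> a i \<ge> 1"
  shows "(\<Sum>m\<in>{0<..<cf_den a l}. f m) = (\<Sum>k\<in>{0<..<l}. \<Sum>m\<in>{cf_den a k..<cf_den a (Suc k)}. f m)"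
  using assms
proof (induction l rule: nat_induct_non_zero)
  case 1
  have "{0<..<1::int} = {}" "{0<..<1::nat} = {}"
    by auto
  then show ?case
    by simp
next
  case (Suc l)
  have "cf_den a l \<ge> 1" "cf_den a l \<le> cf_den a (Suc l)"
    using cf_den_pos[of l a] cf_den_mono[of l a] Suc by auto
  then have "{0<..<cf_den a (Suc l)} = {0<..<cf_den a l} \<union> {cf_den a l..<cf_den a (Suc l)}"
    by auto
  then have "(\<Sum>m\<in>{0<..<cf_den a (Suc l)}. f m) =
      (\<Sum>m\<in>{0<..<cf_den a l}. f m) + (\<Sum>m\<in>{cf_den a l..<cf_den a (Suc l)}. f m)"
    by (simp only:) (rule sum.union_disjoint; auto)
  moreover have "{0<..<Suc l} = insert l {0<..<l}"
    using Suc.hyps by auto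
  ultimately show ?case
    using Suc by (simp del: cf_den.simps)
qed

section \<open>Assembling the blocks\<close>

theorem theorem3:
  fixes \<alpha> p :: real and a :: "nat \<Rightarrow> int" and N :: enat and l :: nat
  assumes "cf_expansion a N \<alpha>"
    and "p > 1"
    and "l > 0"
    and "enat l \<le> N"
  shows "\<bar>(\<Sum>m\<in>{0<..<cf_den a l}.
              1 / (real_of_int m powr p * nearest_int_dist (real_of_int m * \<alpha>) powr p)) powr (1 / p)
          - (\<Sum>k\<in>{0<..<l}. zeta_real (2 * p) * real_of_int (a k) powr p) powr (1 / p)\<bar>
         \<le> 6 powr p * (4 * p\<^sup>2 / (p - 1)\<^sup>2) * real l powr (1 / p)"
proof -
  define f where "f m = 1 / (real_of_int m powr p * nearest_int_dist (real_of_int m * \<alpha>) powr p)"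
    for m
  define C where "C = 6 powr p * (4 * p\<^sup>2 / (p - 1)\<^sup>2)"
  define z where "z = zeta_real (2 * p)"
  define x where "x k = (\<Sum>m\<in>{cf_den a k..<cf_den a (Suc k)}. f m) powr (1 / p)" for k
  define y where "y k = z powr (1 / p) * a k" for k
  have "C \<ge> 0" "z \<ge> 1"
    using zeta_real_ge_1[of "2 * p"] \<open>p > 1\<close> by (simp_all add: C_def z_def)
  have less_N: "enat k < N" if "k < l" for k
    using that \<open>enat l \<le> N\<close> by (meson enat_ord_simps(2) less_le_trans)
  have a_pos: "a k \<ge> 1" if "0 < k" "k < l" for k
    using assms(1) that less_N by (auto simp: cf_expansion_def)
  have close: "\<bar>x k - y k\<bar> \<le> C" if "k \<in> {0<..<l}" for k
  proof -
    interpret consecutive_convergents "(- 1) ^ Suc k * \<alpha>" "cf_den a k" "cf_den a (Suc k)"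
      "(- 1) ^ Suc k * cf_num a k" "(- 1) ^ Suc k * cf_num a (Suc k)" "a k"
      using that less_N by (intro consecutive_convergents_cf[OF assms(1)]) auto
    \<comment> \<open>The sign normalisation of \<alpha> does not change distances to the nearest
      integer.\<close>
    have "block_term p m = f m" for m
      unfolding block_term_def f_def by (cases "even k") (simp_all add: nearest_int_dist_minus)
    then show ?thesis
      using block_norm_estimate[OF \<open>p > 1\<close>] unfolding x_def y_def z_def C_def by simp
  qed
  have nonneg: "x k \<ge> 0" "y k \<ge> 0" if "k \<in> {0<..<l}" for k
    using a_pos[of k] that by (auto simp: x_def y_def)
  have sum_x: "(\<Sum>k\<in>{0<..<l}. x k powr p) = (\<Sum>m\<in>{0<..<cf_den a l}. f m)"
    using \<open>p > 1\<close> sum_cf_den_blocks[of l a f] \<open>l > 0\<close> a_pos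
    by (simp add: x_def powr_powr sum_nonneg f_def)
  have sum_y: "(\<Sum>k\<in>{0<..<l}. y k powr p) = (\<Sum>k\<in>{0<..<l}. z * real_of_int (a k) powr p)"
    using \<open>p > 1\<close> \<open>z \<ge> 1\<close> by (simp add: y_def powr_mult powr_powr)
  \<comment> \<open>The comparison is one-sided, so it is applied twice with \<open>x\<close> and
    \<open>y\<close> exchanged.\<close>
  have "(\<Sum>k\<in>{0<..<l}. x k powr p) powr (1 / p) \<le>
      (\<Sum>k\<in>{0<..<l}. y k powr p) powr (1 / p) + C * real (card {0<..<l}) powr (1 / p)"
    using close nonneg \<open>p > 1\<close> \<open>C \<ge> 0\<close> by (intro Minkowski_sum_diff_le) (auto simp: abs_le_iff algebra_simps)
  moreover have "(\<Sum>k\<in>{0<..<l}. y k powr p) powr (1 / p) \<le>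
      (\<Sum>k\<in>{0<..<l}. x k powr p) powr (1 / p) + C * real (card {0<..<l}) powr (1 / p)"
    using close nonneg \<open>p > 1\<close> \<open>C \<ge> 0\<close> by (intro Minkowski_sum_diff_le) (auto simp: abs_le_iff algebra_simps)
  moreover have "C * real (card {0<..<l}) powr (1 / p) \<le> C * real l powr (1 / p)"
    using \<open>p > 1\<close> \<open>C \<ge> 0\<close> by (intro mult_left_mono powr_root_mono) auto
  ultimately show ?thesis
    unfolding sum_x sum_y f_def[symmetric] C_def[symmetric] z_def[symmetric] by linarith
qed

end
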